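(* Let $X$ be a finite nonempty set, $d$ a dissimilarity measure on $X$, and $\mathcal{L}$ a linkage function on $X$. Then $\mathcal{HC}_{opt}^{\mathcal{L}}$ is permutation invariant: the order of enumeration of the elements of $X$ does not affect the output $\mathcal{HC}_{opt}^{\mathcal{L}}(X,d)$. Precisely: for a bijection $e:\{1,\dots,n\}\to X$ ($n=|X|$), let $d_e(i,j)=d(e(i),e(j))$ and let $\mathcal{L}_e(P,Q,d')=\mathcal{L}\big(e(P),e(Q),d'\circ(e^{-1}\times e^{-1})\big)$. Then the set of dendrograms over $X$ obtained by transporting $\mathcal{HC}_{opt}^{\mathcal{L}_e}(\{1,\dots,n\},d_e)$ to $X$ along $e$ (applying $e$ to every block) is the same for all enumerations $e$.
   Context: $\mathbb{R}_+$ denotes the non-negative reals. A dissimilarity measure on $X$ is a map $d:X\times X\to\mathbb{R}_+$ with $d(x,x)=0$ and $d(x,y)=d(y,x)$; $\mathcal{M}(X)$ is the set of these. A linkage function on $X$ is a map $\mathcal{L}:\mathcal{P}(X)\times\mathcal{P}(X)\times\mathcal{M}(X)\to\mathbb{R}_+$ ($\mathcal{P}(X)$ the power set) such that for each partition $Q$ of $X$ and each $d\in\mathcal{M}(X)$ the restriction of $\mathcal{L}(\cdot,\cdot,d)$ to $Q\times Q$ is a dissimilarity measure on $Q$; only values on pairs of distinct blocks are used. Classical hierarchical clustering $\mathcal{HC}^{\mathcal{L}}(X,d)$ is the following non-deterministic procedure. Start with the partition $Q_0$ into singletons and $\rho_0=0$. Given $Q_i$ with more than one block, choose (arbitrarily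 among ties) a pair of distinct blocks $p,q\in Q_i$ minimising $\mathcal{L}(p,q,d)$, let $Q_{i+1}$ be obtained from $Q_i$ by replacing $p,q$ by $p\cup q$, and let $\rho_{i+1}=\mathcal{L}(p,q,d)$. Stop at $Q_{n-1}=\{X\}$. The output is the map $\theta$ from $\mathbb{R}_+$ to partitions of $X$ given by $\theta(t)=Q_{\max\{i\mid\rho_i\le t\}}$. It is assumed that $\mathcal{L}$ is such that $\rho_0\le\rho_1\le\dots\le\rho_{n-1}$ in every run, so that $\theta$ is monotone. $\mathcal{D}^{\mathcal{L}}(X,d)$ is the set of all possible outputs over all choices. For such $\theta$, $\Psi_X(\theta)(x,y)=\min\{t\in\mathbb{R}_+\mid\exists B\in\theta(t):x,y\in B\}$. Fix $p\in[1,\infty)$ and set $\|f\|_p=\big(\sum_{x,y\in X}|f(x,y)|^p\big)^{1/p}$ for $f:X\times X\to\mathbb{R}$. The optimised hierarchical clustering is the set $$\mathcal{HC}_{opt}^{\mathcal{L}}(X,d)=\operatorname*{arg\,min}_{\theta\in\mathcal{D}^{\mathcal{L}}(X,d)}\|\Psi_X(\theta)-d\|_p$$ of all minimisers. *)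

theory Defs
  imports Complex_Main "HOL-Library.FuncSet" "HOL-Library.Disjoint_Sets"
begin

type_synonym 'a dissim = "'a \<times> 'a \<Rightarrow> real"
type_synonym 'a linkage = "'a set \<Rightarrow> 'a set \<Rightarrow> 'a dissim \<Rightarrow> real"
type_synonym 'a dendrogram = "real \<Rightarrow> 'a set set"

text \<open>Maps defined on \<open>X \<times> X\<close> or on the non-negative reals are represented by functions that are
  extensional on that domain. This matters because a linkage function takes the whole map \<open>d\<close>
  as an argument: it must see only the values of \<open>d\<close> on \<open>X \<times> X\<close>.\<close>

definition dissimilarities :: "'a set \<Rightarrow> 'a dissim set" where
  "dissimilarities X =
     {d \<in> X \<times> X \<rightarrow>\<^sub>E {0..}. (\<forall>x\<in>X. d (x, x) = 0) \<and> (\<forall>x\<in>X. \<forall>y\<in>X. d (x, y) = d (y, x))}"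

definition linkage_function :: "'a set \<Rightarrow> 'a linkage \<Rightarrow> bool" where
  "linkage_function X L \<longleftrightarrow>
     (\<forall>P\<in>Pow X. \<forall>R\<in>Pow X. \<forall>d\<in>dissimilarities X. 0 \<le> L P R d) \<and>
     (\<forall>Q. partition_on X Q \<longrightarrow>
        (\<forall>d\<in>dissimilarities X. (\<lambda>(P, R)\<in>Q \<times> Q. L P R d) \<in> dissimilarities Q))"

text \<open>A run on \<open>n = card X\<close> points is given by \<open>Q i\<close> and \<open>\<rho> i\<close> for \<open>i < n\<close>; the values at
  indices \<open>i \<ge> n\<close> are unconstrained and never used. Every merge removes exactly one block, so
  \<open>Q i\<close> has more than one block iff \<open>Suc i < n\<close>.\<close>

definition hc_run ::
    "'a set \<Rightarrow> 'a linkage \<Rightarrow> 'a dissim \<Rightarrow> (nat \<Rightarrow> 'a set set) \<Rightarrow> (nat \<Rightarrow> real) \<Rightarrow> bool" where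
  "hc_run X L d Q \<rho> \<longleftrightarrow>
     Q 0 = (\<lambda>x. {x}) ` X \<and> \<rho> 0 = 0 \<and>
     (\<forall>i. Suc i < card X \<longrightarrow>
        (\<exists>p q. is_arg_min (\<lambda>(p, q). L p q d) (\<lambda>(p, q). p \<in> Q i \<and> q \<in> Q i \<and> p \<noteq> q) (p, q) \<and>
               Q (Suc i) = insert (p \<union> q) (Q i - {p, q}) \<and>
               \<rho> (Suc i) = L p q d))"

definition hc_output :: "'a set \<Rightarrow> (nat \<Rightarrow> 'a set set) \<Rightarrow> (nat \<Rightarrow> real) \<Rightarrow> 'a dendrogram" where
  "hc_output X Q \<rho> = (\<lambda>t\<in>{0..}. Q (Max {i. i < card X \<and> \<rho> i \<le> t}))"

definition hc_outputs :: "'a set \<Rightarrow> 'a linkage \<Rightarrow> 'a dissim \<Rightarrow> 'a dendrogram set" where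
  "hc_outputs X L d = {hc_output X Q \<rho> | Q \<rho>. hc_run X L d Q \<rho>}"

definition monotone_linkage :: "'a set \<Rightarrow> 'a linkage \<Rightarrow> bool" where
  "monotone_linkage X L \<longleftrightarrow>
     (\<forall>d\<in>dissimilarities X. \<forall>Q \<rho>. hc_run X L d Q \<rho> \<longrightarrow> mono_on {..<card X} \<rho>)"

definition ultrametric_of :: "'a set \<Rightarrow> 'a dendrogram \<Rightarrow> 'a dissim" where
  "ultrametric_of X \<theta> = (\<lambda>(x, y)\<in>X \<times> X. LEAST t. 0 \<le> t \<and> (\<exists>B\<in>\<theta> t. x \<in> B \<and> y \<in> B))"

definition p_norm :: "real \<Rightarrow> 'a set \<Rightarrow> ('a \<times> 'a \<Rightarrow> real) \<Rightarrow> real" where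
  "p_norm p X f = (\<Sum>z\<in>X \<times> X. \<bar>f z\<bar> powr p) powr (1 / p)"

definition hc_opt :: "real \<Rightarrow> 'a set \<Rightarrow> 'a linkage \<Rightarrow> 'a dissim \<Rightarrow> 'a dendrogram set" where
  "hc_opt p X L d =
     {\<theta>. is_arg_min (\<lambda>\<theta>. p_norm p X (\<lambda>z. ultrametric_of X \<theta> z - d z))
                    (\<lambda>\<theta>. \<theta> \<in> hc_outputs X L d) \<theta>}"

text \<open>In the following, \<open>e\<close> is a bijection from \<open>I\<close> onto \<open>X\<close>.\<close>

definition pull_dissim :: "'i set \<Rightarrow> ('i \<Rightarrow> 'a) \<Rightarrow> 'a dissim \<Rightarrow> 'i dissim" where
  "pull_dissim I e d = (\<lambda>(i, j)\<in>I \<times> I. d (e i, e j))"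

definition pull_linkage :: "'i set \<Rightarrow> 'a set \<Rightarrow> ('i \<Rightarrow> 'a) \<Rightarrow> 'a linkage \<Rightarrow> 'i linkage" where
  "pull_linkage I X e L =
     (\<lambda>P Q d'. L (e ` P) (e ` Q) (\<lambda>(x, y)\<in>X \<times> X. d' (inv_into I e x, inv_into I e y)))"

definition transport_dendrogram :: "('i \<Rightarrow> 'a) \<Rightarrow> 'i dendrogram \<Rightarrow> 'a dendrogram" where
  "transport_dendrogram e \<theta> = (\<lambda>t\<in>{0..}. (\<lambda>B. e ` B) ` \<theta> t)"

end

theory Submission
  imports Defs
begin

text \<open>Relabelling the points along a bijection carries runs, outputs, ultrametrics and norms over to
  their counterparts on \<open>X\<close>. So every enumeration yields the same set, namely \<open>hc_opt p X L d\<close>.\<close>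

text \<open>One merge in elimination form: since \<open>real\<close> is linearly ordered,
  \<open>is_arg_min\<close> unfolds into plain inequalities.\<close>

lemma hc_run_step:
  assumes "hc_run X L d Q \<rho>" and "Suc i < card X"
  obtains a b where "a \<in> Q i" "b \<in> Q i" "a \<noteq> b"
    and "\<And>P R. P \<in> Q i \<Longrightarrow> R \<in> Q i \<Longrightarrow> P \<noteq> R \<Longrightarrow> L a b d \<le> L P R d"
    and "Q (Suc i) = insert (a \<union> b) (Q i - {a, b})" and "\<rho> (Suc i) = L a b d"
proof -
  have "\<exists>p q. is_arg_min (\<lambda>(p, q). L p q d) (\<lambda>(p, q). p \<in> Q i \<and> q \<in> Q i \<and> p \<noteq> q) (p, q) \<and>
      Q (Suc i) = insert (p \<union> q) (Q i - {p, q}) \<and> \<rho> (Suc i) = L p q d"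
    using assms by (simp only: hc_run_def)
  then show ?thesis
    by (elim exE conjE, intro that) (simp_all add: is_arg_min_linorder)
qed

text \<open>Taking unions of blocks never leaves \<open>X\<close>. The bound on \<open>i\<close>
  matters because a run is unconstrained from index \<open>card X\<close> on. The lemma confines
  blocks to the region where \<open>image e\<close> is injective and the linkage values are known to
  correspond.\<close>

lemma hc_run_blocks_subset:
  assumes "hc_run X L d Q \<rho>" and "i < card X"
  shows "Q i \<subseteq> Pow X"
  using assms(2)
proof (induction i)
  case 0
  then show ?case using assms(1) by (auto simp: hc_run_def)
next
  case (Suc i)
  from assms(1) Suc.prems obtain a b
    where "a \<in> Q i" "b \<in> Q i" "Q (Suc i) = insert (a \<union> b) (Q i - {a, b})"
    by (rule hc_run_step)
  with Suc show ?case by auto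
qed

text \<open>Each merge of \<open>a\<close>, \<open>b\<close> becomes a merge of their images at the
  same height. The compatibility \<open>link\<close> concerns only the two fixed maps
  \<open>d'\<close> and \<open>d\<close>, so the lemma also applies to the inverse
  bijection.\<close>

lemma hc_run_transport:
  assumes run: "hc_run I L' d' Q \<rho>"
    and bij: "bij_betw e I X"
    and link: "\<And>P R. P \<subseteq> I \<Longrightarrow> R \<subseteq> I \<Longrightarrow> L' P R d' = L (e ` P) (e ` R) d"
  shows "hc_run X L d (\<lambda>i. image e ` Q i) \<rho>"
  unfolding hc_run_def
proof (intro conjI allI impI)
  have card: "card I = card X" using bij by (rule bij_betw_same_card)
  have X: "X = e ` I" and inj: "inj_on e I" using bij by (auto simp: bij_betw_def)
  show "image e ` Q 0 = (\<lambda>x. {x}) ` X" using run by (simp add: hc_run_def X image_image)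
  show "\<rho> 0 = 0" using run by (simp add: hc_run_def)
  fix i assume i: "Suc i < card X"
  then have "Suc i < card I" using card by simp
  with run obtain a b
    where ab: "a \<in> Q i" "b \<in> Q i" "a \<noteq> b"
      and le: "\<And>P R. P \<in> Q i \<Longrightarrow> R \<in> Q i \<Longrightarrow> P \<noteq> R \<Longrightarrow> L' a b d' \<le> L' P R d'"
      and Q: "Q (Suc i) = insert (a \<union> b) (Q i - {a, b})"
      and \<rho>: "\<rho> (Suc i) = L' a b d'"
    by (rule hc_run_step) blast
  have sub: "Q i \<subseteq> Pow I" using hc_run_blocks_subset[OF run, of i] i card by simp
  \<comment> \<open>Injectivity on blocks is used twice: pairs of distinct blocks correspond to
    pairs of distinct images, which transfers minimality, and taking images commutes with removing
    \<open>{a, b}\<close>.\<close>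
  have injQ: "inj_on (image e) (Q i)"
    using inj_on_image_Pow[OF inj] sub by (rule inj_on_subset)
  have link': "L' P R d' = L (e ` P) (e ` R) d" if "P \<in> Q i" "R \<in> Q i" for P R
    using link sub that by blast
  have "is_arg_min (\<lambda>(p, q). L p q d)
          (\<lambda>(p, q). p \<in> image e ` Q i \<and> q \<in> image e ` Q i \<and> p \<noteq> q) (e ` a, e ` b)"
    unfolding is_arg_min_linorder using ab le injQ by (auto simp: inj_on_eq_iff link')
  moreover have "image e ` Q (Suc i) = insert (e ` a \<union> e ` b) (image e ` Q i - {e ` a, e ` b})"
    using inj_on_image_set_diff[OF injQ, of "Q i" "{a, b}"] ab by (simp add: Q image_Un)
  moreover have "\<rho> (Suc i) = L (e ` a) (e ` b) d" using \<rho> ab link' by simp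
  ultimately show "\<exists>p q. is_arg_min (\<lambda>(p, q). L p q d)
        (\<lambda>(p, q). p \<in> image e ` Q i \<and> q \<in> image e ` Q i \<and> p \<noteq> q) (p, q) \<and>
      image e ` Q (Suc i) = insert (p \<union> q) (image e ` Q i - {p, q}) \<and> \<rho> (Suc i) = L p q d"
    by blast
qed

text \<open>The index selected at height \<open>t\<close> depends only on \<open>\<rho>\<close> and
  the number of points, and relabelling changes neither.\<close>

lemma hc_output_transport:
  assumes "card I = card X"
  shows "hc_output X (\<lambda>i. image e ` Q i) \<rho> = transport_dendrogram e (hc_output I Q \<rho>)"
  using assms unfolding hc_output_def transport_dendrogram_def by (intro restrict_ext) simp

text \<open>Index 0 always qualifies because \<open>\<rho> 0 = 0\<close>, so the maximum is over a
  nonempty finite set and is one of its members.\<close>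

lemma hc_output_index_less:
  assumes "hc_run X L d Q \<rho>" and "0 < card X" and "0 \<le> t"
  shows "Max {i. i < card X \<and> \<rho> i \<le> t} < card X"
proof -
  have "0 \<in> {i. i < card X \<and> \<rho> i \<le> t}" using assms by (simp add: hc_run_def)
  then have "Max {i. i < card X \<and> \<rho> i \<le> t} \<in> {i. i < card X \<and> \<rho> i \<le> t}"
    by (intro Max_in) auto
  then show ?thesis by simp
qed

lemma hc_outputs_blocks_subset:
  assumes "\<theta> \<in> hc_outputs X L d" and "0 < card X" and "0 \<le> t"
  shows "\<theta> t \<subseteq> Pow X"
proof -
  obtain Q \<rho> where "\<theta> = hc_output X Q \<rho>" and run: "hc_run X L d Q \<rho>"
    using assms(1) by (auto simp: hc_outputs_def)
  then show ?thesis
    using hc_run_blocks_subset[OF run hc_output_index_less[OF run assms(2,3)]] assms(3)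
    by (simp add: hc_output_def)
qed

lemma hc_outputs_transport:
  assumes bij: "bij_betw e I X" and pos: "0 < card X"
    and link: "\<And>P R. P \<subseteq> I \<Longrightarrow> R \<subseteq> I \<Longrightarrow> L' P R d' = L (e ` P) (e ` R) d"
  shows "transport_dendrogram e ` hc_outputs I L' d' = hc_outputs X L d"
proof
  have card: "card I = card X" using bij by (rule bij_betw_same_card)
  have "hc_run X L d (\<lambda>i. image e ` Q i) \<rho>" if "hc_run I L' d' Q \<rho>" for Q \<rho>
    using that bij link by (rule hc_run_transport)
  then show "transport_dendrogram e ` hc_outputs I L' d' \<subseteq> hc_outputs X L d"
    using hc_output_transport[OF card, symmetric] unfolding hc_outputs_def by blast
  show "hc_outputs X L d \<subseteq> transport_dendrogram e ` hc_outputs I L' d'"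
  proof
    fix \<theta> assume "\<theta> \<in> hc_outputs X L d"
    then obtain Q \<rho> where \<theta>: "\<theta> = hc_output X Q \<rho>" and run: "hc_run X L d Q \<rho>"
      by (auto simp: hc_outputs_def)
    \<comment> \<open>For the reverse inclusion a run on \<open>X\<close> is pulled back along the
      inverse bijection; pushing it forward again must return the given output.\<close>
    let ?g = "inv_into I e"
    have bij': "bij_betw ?g X I" using bij by (rule bij_betw_inv_into)
    have sub: "?g ` P \<subseteq> I" if "P \<subseteq> X" for P
      using bij' that by (auto simp: bij_betw_def)
    have eg: "e ` ?g ` P = P" if "P \<subseteq> X" for P
      using bij_betw_imp_surj_on[OF bij] that by (rule image_inv_into_cancel)
    have "L P R d = L' (?g ` P) (?g ` R) d'" if "P \<subseteq> X" "R \<subseteq> X" for P R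
      using link[OF sub sub, OF that] eg that by simp
    then have run': "hc_run I L' d' (\<lambda>i. image ?g ` Q i) \<rho>"
      using hc_run_transport[OF run bij'] by blast
    have "image e ` image ?g ` Q i = Q i" if "i < card X" for i
    proof -
      have "(\<lambda>B. e ` ?g ` B) ` Q i = (\<lambda>B. B) ` Q i"
        using hc_run_blocks_subset[OF run that] by (intro image_cong refl eg) blast
      then show ?thesis by (simp add: image_image)
    qed
    \<comment> \<open>The two sequences of partitions are known to agree only below
      \<open>card X\<close>; an output reads no other index.\<close>
    then have "hc_output X (\<lambda>i. image e ` image ?g ` Q i) \<rho> = \<theta>"
      using hc_output_index_less[OF run pos] unfolding \<theta> hc_output_def
      by (intro restrict_ext) simp
    then have "\<theta> = transport_dendrogram e (hc_output I (\<lambda>i. image ?g ` Q i) \<rho>)"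
      by (simp add: hc_output_transport[OF card])
    then show "\<theta> \<in> transport_dendrogram e ` hc_outputs I L' d'"
      using run' by (auto simp: hc_outputs_def)
  qed
qed

lemma ultrametric_of_transport:
  assumes bij: "bij_betw e I X" and "i \<in> I" and "j \<in> I"
    and sub: "\<And>t. 0 \<le> t \<Longrightarrow> \<theta> t \<subseteq> Pow I"
  shows "ultrametric_of X (transport_dendrogram e \<theta>) (e i, e j) = ultrametric_of I \<theta> (i, j)"
proof -
  have X: "e i \<in> X" "e j \<in> X" using assms by (auto simp: bij_betw_def)
  have mem: "e k \<in> e ` B \<longleftrightarrow> k \<in> B" if "k \<in> I" "B \<subseteq> I" for k B
    using bij that by (intro inj_on_image_mem_iff[of e I]) (auto simp: bij_betw_def)
  have "(0 \<le> t \<and> (\<exists>B\<in>transport_dendrogram e \<theta> t. e i \<in> B \<and> e j \<in> B)) \<longleftrightarrow>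
        (0 \<le> t \<and> (\<exists>B\<in>\<theta> t. i \<in> B \<and> j \<in> B))" for t
  proof (cases "0 \<le> t")
    case True
    then have "B \<subseteq> I" if "B \<in> \<theta> t" for B using sub that by auto
    then have "e i \<in> e ` B \<longleftrightarrow> i \<in> B" "e j \<in> e ` B \<longleftrightarrow> j \<in> B" if "B \<in> \<theta> t" for B
      using mem that assms(2,3) by simp_all
    with True show ?thesis by (simp add: transport_dendrogram_def)
  qed simp
  then show ?thesis using X assms(2,3) by (simp add: ultrametric_of_def)
qed

lemma p_norm_reindex:
  assumes bij: "bij_betw e I X" and "\<And>i j. i \<in> I \<Longrightarrow> j \<in> I \<Longrightarrow> f (e i, e j) = g (i, j)"
  shows "p_norm p X f = p_norm p I g"
proof -
  have "(\<Sum>z\<in>X \<times> X. \<bar>f z\<bar> powr p) = (\<Sum>z\<in>I \<times> I. \<bar>f (map_prod e e z)\<bar> powr p)"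
    using sum.reindex_bij_betw[OF bij_betw_map_prod[OF bij bij], of "\<lambda>z. \<bar>f z\<bar> powr p"] by simp
  also have "\<dots> = (\<Sum>z\<in>I \<times> I. \<bar>g z\<bar> powr p)"
    using assms(2) by (intro sum.cong) auto
  finally show ?thesis by (simp add: p_norm_def)
qed

text \<open>Whether \<open>x\<close> in \<open>S\<close> is a minimiser depends only on
  \<open>T x\<close>, so \<open>T\<close> may identify points.\<close>

lemma image_arg_min:
  fixes f :: "'b \<Rightarrow> 'c :: linorder"
  assumes "\<And>x. x \<in> S \<Longrightarrow> f (T x) = g x"
  shows "T ` {x. is_arg_min g (\<lambda>x. x \<in> S) x} = {y. is_arg_min f (\<lambda>y. y \<in> T ` S) y}"
proof -
  have "is_arg_min g (\<lambda>x. x \<in> S) x \<longleftrightarrow> x \<in> S \<and> (\<forall>y\<in>T ` S. f (T x) \<le> f y)" for x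
    using assms by (auto simp: is_arg_min_linorder)
  then show ?thesis by (auto simp: is_arg_min_linorder)
qed

text \<open>Pulling \<open>d\<close> back along \<open>e\<close> and then along its inverse restores
  its values on \<open>X \<times> X\<close>. Extensionality turns this into equality of functions,
  as required because \<open>L\<close> takes the whole map as an argument.\<close>

lemma pull_linkage_pull_dissim:
  assumes bij: "bij_betw e I X" and "d \<in> extensional (X \<times> X)"
  shows "pull_linkage I X e L P R (pull_dissim I e d) = L (e ` P) (e ` R) d"
proof -
  have "inv_into I e x \<in> I" "e (inv_into I e x) = x" if "x \<in> X" for x
    using bij that by (auto simp: bij_betw_def inv_into_into f_inv_into_f)
  then have "(\<lambda>(x, y)\<in>X \<times> X. pull_dissim I e d (inv_into I e x, inv_into I e y)) = d"
    using assms(2) by (intro extensionalityI[of _ "X \<times> X"]) (auto simp: pull_dissim_def)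
  then show ?thesis by (simp add: pull_linkage_def)
qed

lemma hc_opt_transport:
  assumes bij: "bij_betw e I X" and pos: "0 < card X" and ext: "d \<in> extensional (X \<times> X)"
  shows "transport_dendrogram e ` hc_opt p I (pull_linkage I X e L) (pull_dissim I e d) =
         hc_opt p X L d"
proof -
  let ?S = "hc_outputs I (pull_linkage I X e L) (pull_dissim I e d)"
  have pos': "0 < card I" using pos bij_betw_same_card[OF bij] by simp
  \<comment> \<open>The objective is preserved only for actual outputs, whose blocks lie in
    \<open>I\<close>; this is all that \<open>image_arg_min\<close> asks for.\<close>
  have norm: "p_norm p X (\<lambda>z. ultrametric_of X (transport_dendrogram e \<theta>) z - d z) =
        p_norm p I (\<lambda>z. ultrametric_of I \<theta> z - pull_dissim I e d z)" if "\<theta> \<in> ?S" for \<theta>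
    using hc_outputs_blocks_subset[OF that pos']
    by (intro p_norm_reindex[OF bij]) (simp add: ultrametric_of_transport[OF bij] pull_dissim_def)
  have "transport_dendrogram e ` ?S = hc_outputs X L d"
    using bij pos pull_linkage_pull_dissim[OF bij ext] by (intro hc_outputs_transport)
  then show ?thesis
    using image_arg_min[where S = ?S and T = "transport_dendrogram e"
        and f = "\<lambda>\<theta>. p_norm p X (\<lambda>z. ultrametric_of X \<theta> z - d z)", OF norm]
    unfolding hc_opt_def by simp
qed

theorem theorem9:
  fixes X :: "'a set" and d :: "'a dissim" and L :: "'a linkage"
    and p :: real and e e' :: "nat \<Rightarrow> 'a"
  assumes "finite X" and "X \<noteq> {}"
    and "d \<in> dissimilarities X"
    and "linkage_function X L"
    and "monotone_linkage X L"
    and "1 \<le> p"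
    and "bij_betw e {1..card X} X"
    and "bij_betw e' {1..card X} X"
  shows "transport_dendrogram e `
           hc_opt p {1..card X} (pull_linkage {1..card X} X e L) (pull_dissim {1..card X} e d) =
         transport_dendrogram e' `
           hc_opt p {1..card X} (pull_linkage {1..card X} X e' L) (pull_dissim {1..card X} e' d)"
proof -
  have pos: "0 < card X" using assms(1,2) by (simp add: card_gt_0_iff)
  have ext: "d \<in> extensional (X \<times> X)" using assms(3) by (auto simp: dissimilarities_def PiE_def)
  show ?thesis
    using hc_opt_transport[OF assms(7) pos ext] hc_opt_transport[OF assms(8) pos ext] by simp
qed

end
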